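(* Let $\Omega$ be a set, let $G = \mathrm{Sym}(\Omega)$, and let $g\in G$. For $k\in\mathbf{N}\cup\{\infty\}$ let $n_k$ be the number of orbits of $g$ of size $k$. (a) The centralizer $\mathrm{Cent}_{G}(g)$ is meet-coherent. (b) If $n_k$ is finite for all $k\neq 1$, including $k = \infty$, then $\mathrm{Cent}_G(g)$ is join-coherent.
   Context: For a group $H$ acting on a set $\Omega$ and $h\in H$, $\pi(h)$ denotes the partition of $\Omega$ into the orbits of $h$, and $\pi(H)=\{\pi(h)\mid h\in H\}$. Partitions of $\Omega$ are ordered by refinement; $\mathcal{P}\vee\mathcal{Q}$ and $\mathcal{P}\wedge\mathcal{Q}$ denote the supremum (join) and infimum (meet) of two partitions. The parts of $\mathcal{P}\wedge\mathcal{Q}$ are the non-empty intersections of a part of $\mathcal{P}$ with a part of $\mathcal{Q}$. $H$ is join-coherent if $\pi(H)$ is closed under $\vee$, and meet-coherent if $\pi(H)$ is closed under $\wedge$. Subgroups of $\mathrm{Sym}(\Omega)$ act naturally on $\Omega$, which may be finite or infinite. *)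

theory Defs
  imports
    "HOL-Algebra.Lattice"
    "HOL-Algebra.Group_Action"
    "HOL-Algebra.Generated_Groups"
    "HOL-Library.Disjoint_Sets"
    "HOL-Library.Extended_Nat"
begin

definition partition_order :: "'a set \<Rightarrow> 'a set set gorder"
  where "partition_order \<Omega> =
    \<lparr>carrier = {P. partition_on \<Omega> P}, eq = (=), le = refines \<Omega>\<rparr>"

definition orbit_partition :: "('g, 'm) monoid_scheme \<Rightarrow> 'a set \<Rightarrow> ('g \<Rightarrow> 'a \<Rightarrow> 'a) \<Rightarrow> 'g \<Rightarrow> 'a set set"
  where "orbit_partition H \<Omega> \<phi> h = orbits (subgroup_generated H {h}) \<Omega> \<phi>"

definition orbit_partitions :: "('g, 'm) monoid_scheme \<Rightarrow> 'a set \<Rightarrow> ('g \<Rightarrow> 'a \<Rightarrow> 'a) \<Rightarrow> 'a set set set"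
  where "orbit_partitions H \<Omega> \<phi> = {orbit_partition H \<Omega> \<phi> h | h. h \<in> carrier H}"

definition join_coherent :: "('g, 'm) monoid_scheme \<Rightarrow> 'a set \<Rightarrow> ('g \<Rightarrow> 'a \<Rightarrow> 'a) \<Rightarrow> bool"
  where "join_coherent H \<Omega> \<phi> \<longleftrightarrow>
    (\<forall>P \<in> orbit_partitions H \<Omega> \<phi>. \<forall>Q \<in> orbit_partitions H \<Omega> \<phi>.
       P \<squnion>\<^bsub>partition_order \<Omega>\<^esub> Q \<in> orbit_partitions H \<Omega> \<phi>)"

definition meet_coherent :: "('g, 'm) monoid_scheme \<Rightarrow> 'a set \<Rightarrow> ('g \<Rightarrow> 'a \<Rightarrow> 'a) \<Rightarrow> bool"
  where "meet_coherent H \<Omega> \<phi> \<longleftrightarrow>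
    (\<forall>P \<in> orbit_partitions H \<Omega> \<phi>. \<forall>Q \<in> orbit_partitions H \<Omega> \<phi>.
       P \<sqinter>\<^bsub>partition_order \<Omega>\<^esub> Q \<in> orbit_partitions H \<Omega> \<phi>)"

definition centralizer :: "('g, 'm) monoid_scheme \<Rightarrow> 'g \<Rightarrow> 'g set"
  where "centralizer G g = {h \<in> carrier G. h \<otimes>\<^bsub>G\<^esub> g = g \<otimes>\<^bsub>G\<^esub> h}"

text \<open>All infinite cardinalities are identified with \<open>\<infinity>\<close>. Orbits of a single permutation
  are countable, so no information about their sizes is lost.\<close>

definition ecard :: "'a set \<Rightarrow> enat"
  where "ecard A = (if finite A then enat (card A) else \<infinity>)"

definition orbit_count :: "('g, 'm) monoid_scheme \<Rightarrow> 'a set \<Rightarrow> ('g \<Rightarrow> 'a \<Rightarrow> 'a) \<Rightarrow> 'g \<Rightarrow> enat \<Rightarrow> enat"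
  where "orbit_count H \<Omega> \<phi> h k = ecard {B \<in> orbit_partition H \<Omega> \<phi> h. ecard B = k}"

text \<open>The lattice operations of HOL-Algebra are obtained by choice, so we check that joins and
  meets of partitions exist and that the actions considered are genuine ones.\<close>

lemma partition_order_simps [simp]:
  "carrier (partition_order \<Omega>) = {P. partition_on \<Omega> P}"
  "(.=\<^bsub>partition_order \<Omega>\<^esub>) = (=)"
  "(\<sqsubseteq>\<^bsub>partition_order \<Omega>\<^esub>) = refines \<Omega>"
  by (simp_all add: partition_order_def)

lemma partial_order_partition_order: "partial_order (partition_order \<Omega>)"
  by unfold_locales (auto intro: refines_refl refines_trans dest: refines_asym)

lemma greatest_common_refinement:
  assumes "partition_on \<Omega> P" "partition_on \<Omega> Q"
  shows "greatest (partition_order \<Omega>) (common_refinement {P, Q}) (Lower (partition_order \<Omega>) {P, Q})"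
  using assms partition_on_common_refinement [of "{P, Q}" \<Omega>]
    refines_common_refinement [of "{P, Q}" \<Omega>] common_refinement_coarsest [of "{P, Q}" \<Omega>]
  by (auto simp: greatest_def Lower_def)

lemma least_common_coarsening:
  assumes "partition_on \<Omega> P" "partition_on \<Omega> Q"
  shows "least (partition_order \<Omega>) (common_refinement {R. refines \<Omega> P R \<and> refines \<Omega> Q R})
           (Upper (partition_order \<Omega>) {P, Q})"
proof -
  let ?U = "{R. refines \<Omega> P R \<and> refines \<Omega> Q R}"
  have U: "partition_on \<Omega> R" if "R \<in> ?U" for R
    using that by (simp add: refines_def)
  have "partition_on \<Omega> ({\<Omega>} - {{}})"
    by (auto simp: partition_on_def disjoint_def)
  moreover have "\<exists>Y\<in>{\<Omega>} - {{}}. X \<subseteq> Y" if "X \<in> S" "partition_on \<Omega> S" for X S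
    using that by (auto simp: partition_on_def)
  ultimately have "{\<Omega>} - {{}} \<in> ?U"
    using assms unfolding refines_def by blast
  then have ne: "?U \<noteq> {}" by blast
  have "refines \<Omega> P (common_refinement ?U)" "refines \<Omega> Q (common_refinement ?U)"
    by (rule common_refinement_coarsest [OF U _ _ ne]; use assms in simp)+
  then have "common_refinement ?U \<in> Upper (partition_order \<Omega>) {P, Q}"
    using partition_on_common_refinement [OF U ne] by (auto simp: Upper_def)
  moreover have "refines \<Omega> (common_refinement ?U) R"
    if "R \<in> Upper (partition_order \<Omega>) {P, Q}" for R
    using that assms by (intro refines_common_refinement [OF U]) (auto simp: Upper_def)
  ultimately show ?thesis
    unfolding least_def using Upper_closed by fastforce
qed

lemma lattice_partition_order: "lattice (partition_order \<Omega>)"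
proof -
  interpret partial_order "partition_order \<Omega>"
    by (rule partial_order_partition_order)
  show ?thesis
    by unfold_locales
      (simp_all, (blast intro: least_common_coarsening greatest_common_refinement)+)
qed

lemma meet_partition_order:
  assumes "partition_on \<Omega> P" "partition_on \<Omega> Q"
  shows "P \<sqinter>\<^bsub>partition_order \<Omega>\<^esub> Q = {A \<inter> B | A B. A \<in> P \<and> B \<in> Q} - {{}}"
proof -
  interpret partial_order "partition_order \<Omega>"
    by (rule partial_order_partition_order)
  have "greatest (partition_order \<Omega>) (P \<sqinter>\<^bsub>partition_order \<Omega>\<^esub> Q) (Lower (partition_order \<Omega>) {P, Q})"
    unfolding meet_def inf_def using greatest_common_refinement [OF assms] by (rule someI)
  with greatest_common_refinement [OF assms]
  have "P \<sqinter>\<^bsub>partition_order \<Omega>\<^esub> Q = common_refinement {P, Q}"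
    by (rule greatest_unique[rotated])
  also have "\<dots> = {A \<inter> B | A B. A \<in> P \<and> B \<in> Q} - {{}}"
  proof (intro equalityI subsetI)
    fix X assume "X \<in> common_refinement {P, Q}"
    then show "X \<in> {A \<inter> B | A B. A \<in> P \<and> B \<in> Q} - {{}}"
      by (auto simp: common_refinement_def PiE_def Pi_def)
  next
    fix X assume "X \<in> {A \<inter> B | A B. A \<in> P \<and> B \<in> Q} - {{}}"
    then obtain A B where X: "X = A \<inter> B" "A \<in> P" "B \<in> Q" "X \<noteq> {}"
      by auto
    show "X \<in> common_refinement {P, Q}"
    proof (cases "P = Q")
      case True
      with X assms have "A = B"
        by (auto simp: partition_on_def disjoint_def)
      with X True show ?thesis
        by (auto simp: common_refinement intro!: bexI [of _ "\<lambda>_. A"])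
    next
      case False
      define f where "f R = (if R = P then A else B)" for R
      have "f P = A" "f Q = B"
        using False by (auto simp: f_def)
      with X(2,3) have "f \<in> (\<Pi> R\<in>{P, Q}. R)" "\<Inter> (f ` {P, Q}) = A \<inter> B"
        by auto
      with X(1,4) show ?thesis
        unfolding common_refinement by blast
    qed
  qed
  finally show ?thesis .
qed

lemma subgroup_centralizer:
  assumes "group G" "g \<in> carrier G"
  shows "subgroup (centralizer G g) G"
proof -
  interpret group G by fact
  show ?thesis
  proof
    fix h assume "h \<in> centralizer G g"
    then have h: "h \<in> carrier G" "h \<otimes>\<^bsub>G\<^esub> g = g \<otimes>\<^bsub>G\<^esub> h"
      by (auto simp: centralizer_def)
    then have "g = inv\<^bsub>G\<^esub> h \<otimes>\<^bsub>G\<^esub> (g \<otimes>\<^bsub>G\<^esub> h)"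
      using assms(2) inv_solve_left [of g h "g \<otimes>\<^bsub>G\<^esub> h"] by simp
    then have "g = (inv\<^bsub>G\<^esub> h \<otimes>\<^bsub>G\<^esub> g) \<otimes>\<^bsub>G\<^esub> h"
      using assms(2) h by (simp add: m_assoc)
    then have "inv\<^bsub>G\<^esub> h \<otimes>\<^bsub>G\<^esub> g = g \<otimes>\<^bsub>G\<^esub> inv\<^bsub>G\<^esub> h"
      using assms(2) h inv_solve_right [of "inv\<^bsub>G\<^esub> h \<otimes>\<^bsub>G\<^esub> g" g h] by simp
    with h show "inv\<^bsub>G\<^esub> h \<in> centralizer G g"
      by (simp add: centralizer_def)
  next
    fix h k assume "h \<in> centralizer G g" "k \<in> centralizer G g"
    with assms(2) show "h \<otimes>\<^bsub>G\<^esub> k \<in> centralizer G g"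
      by (auto simp: centralizer_def) (metis m_assoc)
  qed (use assms(2) in \<open>auto simp: centralizer_def\<close>)
qed

lemma group_action_subgroup_BijGroup:
  assumes "subgroup H (BijGroup \<Omega>)"
  shows "group_action (BijGroup \<Omega>\<lparr>carrier := H\<rparr>) \<Omega> (\<lambda>h. h)"
proof -
  interpret group "BijGroup \<Omega>" by (rule group_BijGroup)
  show ?thesis
    using assms canonical_inj_is_hom [OF assms]
    by (simp add: group_action_def id_def)
qed

lemma partition_on_orbit_partition:
  assumes "group_action H \<Omega> \<phi>"
  shows "partition_on \<Omega> (orbit_partition H \<Omega> \<phi> h)"
proof -
  interpret group_action H \<Omega> \<phi> by fact
  interpret group H using group_hom group_hom.axioms(1) by blast
  have hom: "\<phi> \<in> hom (subgroup_generated H {h}) (BijGroup \<Omega>)"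
    using group_hom by (auto simp: group_hom_def group_hom_axioms_def hom_from_subgroup_generated)
  interpret S: group_action "subgroup_generated H {h}" \<Omega> \<phi>
    using hom group_BijGroup group_subgroup_generated
    by (simp add: group_action_def group_hom_def group_hom_axioms_def)
  show ?thesis
    unfolding orbit_partition_def
  proof (rule partition_onI)
    show "\<Union> (orbits (subgroup_generated H {h}) \<Omega> \<phi>) = \<Omega>"
      by (rule S.orbits_coverture)
    show "disjnt p q" if "p \<in> orbits (subgroup_generated H {h}) \<Omega> \<phi>"
      "q \<in> orbits (subgroup_generated H {h}) \<Omega> \<phi>" "p \<noteq> q" for p q
      using S.disjoint_union that by (auto simp: disjnt_def)
    show "{} \<notin> orbits (subgroup_generated H {h}) \<Omega> \<phi>"
      using S.orbit_refl by (auto simp: orbits_def)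
  qed
qed

end

theory Submission
  imports Defs "HOL-Library.Countable_Set"
begin

text \<open>Let \<open>E\<close> be a \<open>g\<close>-invariant partition into countable blocks such that points of the same block
  have the same stabilizer in \<open>\<langle>g\<rangle>\<close>. If each block \<open>A\<close> either meets only finitely many \<open>g\<close>-orbits or
  is fixed pointwise by every power of \<open>g\<close> that stabilizes it, then \<open>E\<close> is the orbit partition of
  some \<open>z\<close> commuting with \<open>g\<close>. Indeed, let \<open>\<langle>g\<^sup>m\<rangle>\<close> be the stabilizer of \<open>A\<close>. In the first case choose
  representatives \<open>t\<^sub>0, \<dots>, t\<^sub>s\<close> of the \<open>g\<close>-orbits meeting \<open>A\<close> and let \<open>z\<close> send
  \<open>t\<^sub>0\<close> to \<open>t\<^sub>1\<close>, \<open>\<dots>\<close>, \<open>t\<^sub>s\<close> to \<open>g\<^sup>m t\<^sub>0\<close>; in the second let \<open>z\<close> be any transitive permutation of \<open>A\<close>.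
  Extend \<open>z\<close> to the translates of \<open>A\<close> by \<open>z (g\<^sup>j a) = g\<^sup>j (z a)\<close>.

  If \<open>E\<close> refines the orbits of some \<open>h\<close> commuting with \<open>g\<close>, as a meet does, and \<open>g\<^sup>i\<close> acts
  nontrivially on a block in the way \<open>h\<^sup>j\<close> does, then the block meets at most \<open>\<bar>j\<bar>\<close> orbits of \<open>g\<close>.
  A block of a join is an orbit of a group centralizing \<open>g\<close>, so all \<open>g\<close>-orbits meeting it have the
  same size \<open>k\<close>; for \<open>k \<noteq> 1\<close> there are finitely many of them by hypothesis, and for
  \<open>k = 1\<close> the block is fixed pointwise.\<close>

section \<open>Integer powers of a bijection\<close>

text \<open>Powers are taken of plain total functions, outside any group, so that they compose by
  ordinary application. The exponent laws are established for bijective \<open>f\<close>.\<close>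

definition zpow :: "('a \<Rightarrow> 'a) \<Rightarrow> int \<Rightarrow> 'a \<Rightarrow> 'a"
  where "zpow f i = (if 0 \<le> i then f ^^ nat i else inv_into UNIV f ^^ nat (- i))"

definition same_orbit :: "('a \<Rightarrow> 'a) \<Rightarrow> 'a \<Rightarrow> 'a \<Rightarrow> bool"
  where "same_orbit f x y \<longleftrightarrow> (\<exists>i. y = zpow f i x)"

lemma zpow_0 [simp]: "zpow f 0 x = x"
  by (simp add: zpow_def)

lemma zpow_1 [simp]: "zpow f 1 x = f x"
  by (simp add: zpow_def)

lemma zpow_Suc:
  assumes "bij f" shows "zpow f (i + 1) x = f (zpow f i x)"
proof (cases "0 \<le> i")
  case True
  then have "nat (i + 1) = Suc (nat i)" by simp
  with True show ?thesis by (simp add: zpow_def)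
next
  case False
  then have *: "nat (- i) = Suc (nat (- (i + 1)))" by simp
  have "f (zpow f i x) = (inv_into UNIV f ^^ nat (- (i + 1))) x"
    using False unfolding zpow_def * by (simp add: surj_f_inv_f [OF bij_is_surj [OF assms]])
  also have "\<dots> = zpow f (i + 1) x"
    using False by (auto simp: zpow_def)
  finally show ?thesis ..
qed

lemma zpow_diff_1:
  assumes "bij f" shows "zpow f (i - 1) x = inv_into UNIV f (zpow f i x)"
  using zpow_Suc [OF assms, of "i - 1" x] assms by (simp add: bij_is_inj)

lemma zpow_add:
  assumes "bij f" shows "zpow f (i + j) x = zpow f i (zpow f j x)"
proof (induction i rule: int_induct [of _ 0])
  case (step1 i)
  then show ?case using zpow_Suc [OF assms, of "i + j" x] zpow_Suc [OF assms, of i]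
    by (simp add: algebra_simps)
next
  case (step2 i)
  then show ?case using zpow_diff_1 [OF assms, of "i + j" x] zpow_diff_1 [OF assms, of i]
    by (simp add: algebra_simps)
qed simp

lemma zpow_commute:
  assumes f: "bij f" and fh: "\<And>x. h (f x) = f (h x)"
  shows "h (zpow f i x) = zpow f i (h x)"
proof (induction i rule: int_induct [of _ 0])
  case (step1 i)
  then show ?case by (simp add: zpow_Suc [OF f] fh)
next
  case (step2 i)
  have "f (h (zpow f (i - 1) x)) = h (zpow f i x)"
    using zpow_Suc [OF f, of "i - 1" x] by (simp add: fh)
  also have "\<dots> = f (zpow f (i - 1) (h x))"
    using zpow_Suc [OF f, of "i - 1" "h x"] step2 by simp
  finally show ?case using f by (simp add: bij_is_inj inj_eq)
qed simp

lemma zpow_commute2: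
  assumes "bij f" "bij h" "\<And>x. h (f x) = f (h x)"
  shows "zpow h j (zpow f i x) = zpow f i (zpow h j x)"
  using zpow_commute [OF assms(2), of "zpow f i"] zpow_commute [OF assms(1), of h] assms(3)
  by metis

lemma zpow_minus_cancel:
  assumes "bij f" shows "zpow f (- i) (zpow f i x) = x"
  using zpow_add [OF assms, of "- i" i x] by simp

lemma zpow_cancel_minus:
  assumes "bij f" shows "zpow f i (zpow f (- i) x) = x"
  using zpow_add [OF assms, of i "- i" x] by simp

lemma zpow_eq_iff:
  assumes "bij f" shows "zpow f i x = zpow f j y \<longleftrightarrow> zpow f (i - j) x = y"
proof -
  have "zpow f i x = zpow f j (zpow f (i - j) x)"
    using zpow_add [OF assms, of j "i - j" x] by simp
  then show ?thesis
    by (metis zpow_minus_cancel [OF assms])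
qed

lemma zpow_fixed:
  assumes "bij f" "zpow f i x = x" shows "zpow f (i * q) x = x"
proof (induction q rule: int_induct [of _ 0])
  case (step1 q)
  have "zpow f (i * (q + 1)) x = zpow f (i * q) (zpow f i x)"
    using zpow_add [OF assms(1), of "i * q" i x] by (simp add: algebra_simps)
  then show ?case using step1 assms by simp
next
  case (step2 q)
  have "zpow f (i * q) x = zpow f (i * (q - 1)) (zpow f i x)"
    using zpow_add [OF assms(1), of "i * (q - 1)" i x] by (simp add: algebra_simps)
  then show ?case using step2 assms by simp
qed simp

text \<open>The powers \<open>zpow f i\<close> and \<open>zpow h j\<close> agree at \<open>x\<close>
  and commute, so factors can be exchanged one at a time. This later trades powers of
  \<open>h\<close> for powers of \<open>g\<close>.\<close>

lemma zpow_cong_mult: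
  assumes f: "bij f" and h: "bij h" and fh: "\<And>x. h (f x) = f (h x)"
    and "zpow f i x = zpow h j x"
  shows "zpow f (i * q) x = zpow h (j * q) x"
proof (induction q rule: int_induct [of _ 0])
  case (step1 q)
  have "zpow f (i * (q + 1)) x = zpow f i (zpow f (i * q) x)"
    using zpow_add [OF f, of i "i * q" x] by (simp add: algebra_simps)
  also have "\<dots> = zpow h (j * q) (zpow f i x)"
    using step1 zpow_commute2 [OF f h fh] by simp
  also have "\<dots> = zpow h (j * (q + 1)) x"
    using assms(4) zpow_add [OF h, of "j * q" j x] by (simp add: algebra_simps)
  finally show ?case .
next
  case (step2 q)
  have "zpow f i (zpow f (i * (q - 1)) x) = zpow h (j * q) x"
    using step2 zpow_add [OF f, of i "i * (q - 1)" x] by (simp add: algebra_simps)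
  also have "\<dots> = zpow h (j * (q - 1)) (zpow h j x)"
    using zpow_add [OF h, of "j * (q - 1)" j x] by (simp add: algebra_simps)
  also have "\<dots> = zpow f i (zpow h (j * (q - 1)) x)"
    unfolding assms(4) [symmetric] by (rule zpow_commute2 [OF f h fh])
  finally show ?case by (simp add: zpow_eq_iff [OF f])
qed simp

section \<open>The orbit relation of a bijection\<close>

lemma same_orbit_equivp:
  assumes f: "bij f" shows "equivp (same_orbit f)"
proof (rule equivpI)
  show "reflp (same_orbit f)"
  proof (rule reflpI)
    fix x
    have "x = zpow f 0 x" by simp
    then show "same_orbit f x x" unfolding same_orbit_def by (rule exI)
  qed
  show "symp (same_orbit f)"
  proof (rule sympI)
    fix x y assume "same_orbit f x y"
    then obtain i where "y = zpow f i x" unfolding same_orbit_def by (rule exE)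
    then have "x = zpow f (- i) y" by (simp add: zpow_minus_cancel [OF f])
    then show "same_orbit f y x" unfolding same_orbit_def by (rule exI)
  qed
  show "transp (same_orbit f)"
  proof (rule transpI)
    fix x y w assume "same_orbit f x y" "same_orbit f y w"
    then obtain i j where "y = zpow f i x" "w = zpow f j y" unfolding same_orbit_def by (elim exE)
    then have "w = zpow f (j + i) x" by (simp add: zpow_add [OF f])
    then show "same_orbit f x w" unfolding same_orbit_def by (rule exI)
  qed
qed

lemma countable_same_orbit: "countable (Collect (same_orbit f x))"
proof -
  have "Collect (same_orbit f x) = range (\<lambda>i. zpow f i x)"
    by (auto simp: same_orbit_def)
  then show ?thesis by simp
qed

section \<open>Realizing an invariant partition by a commuting bijection\<close>

text \<open>\<open>\<phi>\<close> presents \<open>z\<close> on one block of a partition as the translation \<open>\<phi> i \<mapsto> \<phi> (i + 1)\<close>;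
  the equivalence makes this translation compatible with every power of \<open>g\<close> stabilizing the block.\<close>

definition cyclic_parametrization :: "('a \<Rightarrow> 'a) \<Rightarrow> (int \<Rightarrow> 'a) \<Rightarrow> bool"
  where "cyclic_parametrization g \<phi> \<longleftrightarrow>
    (\<forall>j i i'. zpow g j (\<phi> i) = \<phi> i' \<longleftrightarrow> zpow g j (\<phi> (i + 1)) = \<phi> (i' + 1))"

text \<open>The generator is the least positive element, or 0 if there is none: remainders modulo it
  stay in \<open>K\<close> and are smaller, hence vanish. The subgroup of interest consists of the
  exponents stabilizing a block.\<close>

lemma int_subgroup_generator:
  fixes K :: "int set"
  assumes "0 \<in> K" and diff: "\<And>i j. i \<in> K \<Longrightarrow> j \<in> K \<Longrightarrow> i - j \<in> K"
  obtains m where "K = range (\<lambda>q. m * q)"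
proof (cases "K \<subseteq> {0}")
  case True
  then have "K = range (\<lambda>q. 0 * q)" using assms(1) by auto
  then show ?thesis by (rule that)
next
  case False
  have neg: "- i \<in> K" if "i \<in> K" for i
    using diff [OF assms(1) that] by simp
  have add: "i + j \<in> K" if "i \<in> K" "j \<in> K" for i j
    using diff [OF that(1) neg [OF that(2)]] by simp
  obtain k where k: "k \<in> K" "k \<noteq> 0" using False by auto
  then have "\<exists>n. 0 < n \<and> int n \<in> K"
    using neg [of k] by (intro exI [of _ "nat \<bar>k\<bar>"]) (auto simp: abs_if)
  define m where "m = (LEAST n. 0 < n \<and> int n \<in> K)"
  have m: "0 < m" "int m \<in> K"
    using LeastI_ex [OF \<open>\<exists>n. 0 < n \<and> int n \<in> K\<close>] by (auto simp: m_def)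
  have mult: "int m * q \<in> K" for q
  proof (induction q rule: int_induct [of _ 0])
    case (step1 q)
    then show ?case using add [of "int m * q" "int m"] m by (simp add: algebra_simps)
  next
    case (step2 q)
    then show ?case using diff [of "int m * q" "int m"] m by (simp add: algebra_simps)
  qed (simp add: assms(1))
  have "i \<in> range (\<lambda>q. int m * q)" if "i \<in> K" for i
  proof -
    have "i mod int m \<in> K"
      using diff [OF that mult [of "i div int m"]] by (simp add: minus_mult_div_eq_mod)
    moreover have "0 \<le> i mod int m" "i mod int m < int m" using m by simp_all
    ultimately have "\<not> 0 < nat (i mod int m)"
      using not_less_Least [of "nat (i mod int m)" "\<lambda>n. 0 < n \<and> int n \<in> K"]
      by (fold m_def) auto
    then have "i mod int m = 0" using \<open>0 \<le> i mod int m\<close> by simp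
    then show ?thesis by (auto simp: mod_eq_0_iff_dvd dvd_def)
  qed
  with mult have "K = range (\<lambda>q. int m * q)" by auto
  then show ?thesis by (rule that)
qed

text \<open>Equality of stabilizers within a block follows from \<open>semiregular\<close> and the
  symmetry of \<open>E\<close>. The set \<open>F\<close> in \<open>few_orbits\<close> may contain
  points outside the block.\<close>

locale invariant_equivalence =
  fixes g :: "'a \<Rightarrow> 'a" and E :: "'a \<Rightarrow> 'a \<Rightarrow> bool"
  assumes bij: "bij g"
    and equiv: "equivp E"
    and invariant: "E x y \<Longrightarrow> E (zpow g i x) (zpow g i y)"
    and semiregular: "E x y \<Longrightarrow> zpow g i x = x \<Longrightarrow> zpow g i y = y"
    and countable_class: "countable (Collect (E x))"
    and few_orbits:
      "(\<exists>F. finite F \<and> (\<forall>y. E x y \<longrightarrow> (\<exists>t\<in>F. same_orbit g t y))) \<or>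
       (\<forall>i. E (zpow g i x) x \<longrightarrow> zpow g i x = x)"
begin

lemmas E_refl = equivp_reflp [OF equiv]
lemmas E_sym = equivp_symp [OF equiv]
lemmas E_trans = equivp_transp [OF equiv]

lemmas so_refl = equivp_reflp [OF same_orbit_equivp [OF bij]]
lemmas so_sym = equivp_symp [OF same_orbit_equivp [OF bij]]
lemmas so_trans = equivp_transp [OF same_orbit_equivp [OF bij]]

section \<open>Cyclic parametrization of a single block\<close>

lemma invariant_iff: "E (zpow g i x) (zpow g i y) \<longleftrightarrow> E x y"
  using invariant [of x y i] invariant [of "zpow g i x" "zpow g i y" "- i"]
  by (auto simp: zpow_minus_cancel [OF bij])

text \<open>List one representative of each \<open>g\<close>-orbit meeting the block and run through
  the list cyclically, applying the generator \<open>zpow g m\<close> of the block stabilizer once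
  per round. For \<open>m = 0\<close> the list simply recurs.\<close>

lemma parametrization_finite:
  assumes fin: "finite F" and F: "\<And>y. E c y \<Longrightarrow> \<exists>t\<in>F. same_orbit g t y"
  shows "\<exists>\<phi>. cyclic_parametrization g \<phi> \<and> range \<phi> = Collect (E c)"
proof -
  define K where "K = {i. E (zpow g i c) c}"
  \<comment> \<open>Membership in \<open>K\<close> can be tested on any pair of points of the block,
    not only on \<open>c\<close>.\<close>
  have K: "i \<in> K" if "E (zpow g i a) b" "E c a" "E c b" for i a b
    unfolding K_def using E_trans [OF E_trans [OF invariant [OF that(2)] that(1)] E_sym [OF that(3)]]
    by simp
  have "i - j \<in> K" if "i \<in> K" "j \<in> K" for i j
  proof -
    have "E (zpow g i c) (zpow g j c)" using that unfolding K_def by (blast intro: E_sym E_trans)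
    then have "E (zpow g (- j) (zpow g i c)) (zpow g (- j) (zpow g j c))" by (rule invariant)
    then show ?thesis
      using zpow_add [OF bij, of "- j" i c] by (simp add: K_def zpow_minus_cancel [OF bij])
  qed
  moreover have "0 \<in> K" by (simp add: K_def E_refl)
  ultimately obtain m where m: "K = range (\<lambda>q. m * q)"
    using int_subgroup_generator by metis
  have mK: "E c (zpow g (m * q) a)" if "E c a" for q a
  proof -
    have "m * q \<in> K" using m by auto
    then have "E (zpow g (m * q) c) c" by (simp add: K_def)
    from E_trans [OF E_sym [OF this] invariant [OF that]] show ?thesis .
  qed
  \<comment> \<open>The choice depends on \<open>y\<close> only through its \<open>g\<close>-orbit,
    so all points of one orbit receive the same representative.\<close>
  define s where "s y = (SOME t. E c t \<and> same_orbit g y t)" for y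
  have s_ex: "E c (s y) \<and> same_orbit g y (s y)" if "E c y" for y
    unfolding s_def by (rule someI [of _ y]) (simp add: that so_refl)
  have s_cong: "s y = s y'" if "same_orbit g y y'" for y y'
  proof -
    have "same_orbit g y = same_orbit g y'"
      using that same_orbit_equivp [OF bij] by (simp add: equivp_def)
    then show ?thesis by (simp add: s_def)
  qed
  define T where "T = s ` Collect (E c)"
  have T_E: "E c t" if "t \<in> T" for t
    using that s_ex by (auto simp: T_def)
  have T_unique: "t = t'" if "t \<in> T" "t' \<in> T" "same_orbit g t t'" for t t'
  proof -
    obtain y where y: "E c y" "t = s y" using \<open>t \<in> T\<close> unfolding T_def by blast
    obtain y' where y': "E c y'" "t' = s y'" using \<open>t' \<in> T\<close> unfolding T_def by blast
    have "same_orbit g y t" "same_orbit g y' t'" using s_ex y y' by auto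
    then have "same_orbit g y y'" using so_trans [OF so_trans [OF _ that(3)] so_sym] by blast
    from s_cong [OF this] show ?thesis using y y' by simp
  qed
  \<comment> \<open>Each representative is sent to a point of \<open>F\<close> in its own orbit.
    Distinct representatives have distinct orbits, so \<open>T\<close> is no larger than
    \<open>F\<close>.\<close>
  obtain h where h: "h t \<in> F" "same_orbit g (h t) t" if "t \<in> T" for t
    using F T_E by metis
  have "inj_on h T"
  proof (rule inj_onI)
    fix t t' assume t: "t \<in> T" "t' \<in> T" "h t = h t'"
    then have "same_orbit g (h t) t" "same_orbit g (h t) t'" using h(2) by metis+
    then show "t = t'" using T_unique [OF t(1,2) so_trans [OF so_sym]] by blast
  qed
  moreover have "h ` T \<subseteq> F" using h by auto
  ultimately have "finite T" using fin inj_on_finite by blast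
  define r where "r = int (card T)"
  have "s c \<in> T" by (auto simp: T_def E_refl)
  then have r: "0 < r" using \<open>finite T\<close> by (auto simp: r_def card_gt_0_iff)
  obtain e where e: "bij_betw e {0..<card T} T"
    using ex_bij_betw_nat_finite [OF \<open>finite T\<close>] by blast
  define u where "u i = e (nat (i mod r))" for i
  have nat_mod: "nat (i mod r) \<in> {0..<card T}" for i
    using r by (simp add: r_def nat_less_iff)
  have u_T: "u i \<in> T" for i
    using bij_betwE [OF e] nat_mod unfolding u_def by blast
  have u_eq: "i mod r = i' mod r" if "u i = u i'" for i i'
  proof -
    have "nat (i mod r) = nat (i' mod r)"
      using that nat_mod e unfolding u_def bij_betw_def inj_on_def by blast
    then show ?thesis using r by (metis nat_eq_iff2 pos_mod_sign)
  qed
  \<comment> \<open>As \<open>div\<close> rounds downwards for \<open>r > 0\<close>, the formula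
    also covers negative indices: raising the index by \<open>r * q\<close> adds \<open>q\<close>
    rounds.\<close>
  define \<phi> where "\<phi> i = zpow g (m * (i div r)) (u i)" for i
  have shift: "\<phi> (i + r * q) = zpow g (m * q) (\<phi> i)" for i q
    using r zpow_add [OF bij, of "m * q" "m * (i div r)" "u i"]
    by (simp add: \<phi>_def u_def distrib_left add.commute)
  have \<phi>_E: "E c (\<phi> i)" for i
    unfolding \<phi>_def by (intro mK T_E u_T)
  have so: "same_orbit g (u i) (\<phi> i)" for i
    by (auto simp: \<phi>_def same_orbit_def)
  \<comment> \<open>The values at \<open>i\<close> and \<open>i'\<close> share a
    \<open>g\<close>-orbit only if their representatives coincide, that is, if the indices are
    congruent modulo \<open>r\<close>.\<close>
  have eq_shift: "\<exists>q. i' = i + r * q" if "zpow g j (\<phi> i) = \<phi> i'" for i i' j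
  proof -
    have "same_orbit g (\<phi> i) (\<phi> i')"
      unfolding same_orbit_def using that by metis
    from so_trans [OF so_trans [OF so this] so_sym [OF so]] have "u i = u i'"
      by (rule T_unique [OF u_T u_T])
    then have "r dvd i' - i" using u_eq by (metis mod_eq_dvd_iff)
    then show ?thesis by (auto simp: dvd_def algebra_simps)
  qed
  \<comment> \<open>By \<open>shift\<close>, each side says that \<open>zpow g (j - m * q)\<close>
    fixes a point of the block, so \<open>semiregular\<close> carries one to the other.\<close>
  have step: "zpow g j (\<phi> i) = \<phi> (i + r * q) \<longleftrightarrow> zpow g j (\<phi> (i + 1)) = \<phi> (i + 1 + r * q)"
    for i j q
    unfolding shift zpow_eq_iff [OF bij]
    using semiregular E_trans [OF E_sym [OF \<phi>_E] \<phi>_E] by blast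
  have "cyclic_parametrization g \<phi>"
    unfolding cyclic_parametrization_def
  proof (intro allI)
    fix j i i'
    show "zpow g j (\<phi> i) = \<phi> i' \<longleftrightarrow> zpow g j (\<phi> (i + 1)) = \<phi> (i' + 1)"
    proof (cases "\<exists>q. i' = i + r * q")
      case True
      then obtain q where q: "i' = i + r * q" by blast
      then have "i' + 1 = i + 1 + r * q" by simp
      from step [of j i q, folded q this] show ?thesis .
    next
      case False
      then have "zpow g j (\<phi> i) \<noteq> \<phi> i'" using eq_shift by blast
      moreover have "zpow g j (\<phi> (i + 1)) \<noteq> \<phi> (i' + 1)"
      proof
        assume "zpow g j (\<phi> (i + 1)) = \<phi> (i' + 1)"
        then obtain q where "i' + 1 = i + 1 + r * q" using eq_shift by blast
        with False show False by auto
      qed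
      ultimately show ?thesis by simp
    qed
  qed
  moreover have "range \<phi> = Collect (E c)"
  proof (intro equalityI subsetI)
    fix b assume "b \<in> Collect (E c)"
    then have b: "E c b" by simp
    have "s b \<in> T" using b unfolding T_def by blast
    then have "s b \<in> e ` {0..<card T}" using e by (simp add: bij_betw_def)
    then obtain k where k: "s b = e k" "k \<in> {0..<card T}" by (rule imageE)
    have sb: "E c (s b)" "same_orbit g (s b) b" using s_ex [OF b] so_sym by simp_all
    obtain l where l: "b = zpow g l (s b)"
      using sb(2) unfolding same_orbit_def by (rule exE)
    \<comment> \<open>The exponent leading from the representative to \<open>b\<close> joins two
      points of the block, hence stabilizes it and is a multiple of \<open>m\<close>.\<close>
    have "l \<in> K" by (rule K [OF _ sb(1) b]) (simp add: l [symmetric] E_refl)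
    then obtain q where "l = m * q" unfolding m by (rule imageE)
    moreover have "\<phi> (int k) = s b"
      using k by (simp add: \<phi>_def u_def r_def)
    ultimately have "b = \<phi> (int k + r * q)" using l unfolding shift by simp
    then show "b \<in> range \<phi>" by blast
  qed (use \<phi>_E in auto)
  ultimately show ?thesis by blast
qed

text \<open>Every power of \<open>g\<close> stabilizing the block is trivial on it, so any bijection
  from the integers is compatible with these powers.\<close>

lemma parametrization_infinite:
  assumes fixed: "\<And>i. E (zpow g i c) c \<Longrightarrow> zpow g i c = c" and "infinite (Collect (E c))"
  shows "\<exists>\<phi>. cyclic_parametrization g \<phi> \<and> range \<phi> = Collect (E c)"
proof -
  have "\<exists>f :: int \<Rightarrow> 'a. bij_betw f UNIV (Collect (E c))"
    using countableE_infinite [OF countable_class [of c] assms(2)]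
      countableE_infinite [of "UNIV :: int set"]
    by (metis bij_betw_inv bij_betw_trans countableI_type infinite_UNIV_int)
  then obtain \<phi> :: "int \<Rightarrow> 'a" where \<phi>: "inj \<phi>" "range \<phi> = Collect (E c)"
    by (auto simp: bij_betw_def)
  have \<phi>_E: "E (\<phi> i) (\<phi> i')" for i i'
    using \<phi>(2) by (blast intro: E_sym E_trans)
  have fix_c: "zpow g j c = c" if "zpow g j (\<phi> i) = \<phi> i'" for i i' j
  proof -
    have "E (zpow g j c) (zpow g j (\<phi> i))" using \<phi>(2) by (blast intro: invariant)
    moreover have "E (zpow g j (\<phi> i)) c" using \<phi>(2) that by (auto intro: E_sym)
    ultimately show ?thesis by (rule fixed [OF E_trans])
  qed
  \<comment> \<open>The right-hand side is unchanged when both indices grow by 1, which is exactly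
    the parametrization condition.\<close>
  have *: "zpow g j (\<phi> i) = \<phi> i' \<longleftrightarrow> zpow g j c = c \<and> i = i'" for j i i'
  proof -
    have "zpow g j (\<phi> i) = \<phi> i" if "zpow g j c = c"
      using semiregular [OF _ that] \<phi>(2) by blast
    then show ?thesis using fix_c [of j i i'] \<phi>(1) by (auto simp: inj_eq)
  qed
  then have "cyclic_parametrization g \<phi>"
    by (simp add: cyclic_parametrization_def)
  with \<phi>(2) show ?thesis by blast
qed

lemma parametrization:
  "\<exists>\<phi>. cyclic_parametrization g \<phi> \<and> range \<phi> = Collect (E c)"
proof (cases "\<exists>F. finite F \<and> (\<forall>y. E c y \<longrightarrow> (\<exists>t\<in>F. same_orbit g t y))")
  case True
  then show ?thesis using parametrization_finite by blast
next
  case False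
  \<comment> \<open>A finite block could itself serve as \<open>F\<close>.\<close>
  then have "infinite (Collect (E c))" using so_refl by blast
  then show ?thesis using parametrization_infinite few_orbits [of c] False by blast
qed

text \<open>One block is parametrized for each \<open>g\<close>-orbit of blocks; \<open>rep\<close> selects it.\<close>

theorem commuting_bijection_with_orbits:
  obtains z where "bij z" "\<And>x. z (g x) = g (z x)" "same_orbit z = E"
proof -
  \<comment> \<open>The class of a point under \<open>L\<close> is the union of all translates of
    its block.\<close>
  define L where "L a b \<longleftrightarrow> (\<exists>i. E (zpow g i a) b)" for a b
  have L_refl: "L a a" for a
    unfolding L_def using E_refl by (metis zpow_0)
  have L_sym: "L b a" if "L a b" for a b
  proof -
    from that obtain i where "E (zpow g i a) b" unfolding L_def ..
    from E_sym [OF invariant [OF this, of "- i"]] have "E (zpow g (- i) b) a"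
      by (simp only: zpow_minus_cancel [OF bij])
    then show ?thesis unfolding L_def ..
  qed
  have L_trans: "L a d" if "L a b" "L b d" for a b d
  proof -
    from that obtain i j where "E (zpow g i a) b" "E (zpow g j b) d" unfolding L_def by iprover
    from E_trans [OF invariant [OF this(1)] this(2)] have "E (zpow g (j + i) a) d"
      by (simp only: zpow_add [OF bij])
    then show ?thesis unfolding L_def ..
  qed
  define rep where "rep a = (SOME b. L a b)" for a
  have L_rep: "L a (rep a)" for a
    unfolding rep_def by (rule someI) (rule L_refl)
  have rep_cong: "rep a = rep b" if "L a b" for a b
  proof -
    have "L a = L b" using that by (blast intro: L_sym L_trans)
    then show ?thesis by (simp add: rep_def)
  qed
  obtain \<phi> where \<phi>: "cyclic_parametrization g (\<phi> c)" "range (\<phi> c) = Collect (E c)" for c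
    using parametrization by metis
  have star: "zpow g j (\<phi> c i) = \<phi> c i' \<longleftrightarrow> zpow g j (\<phi> c (i + 1)) = \<phi> c (i' + 1)" for c j i i'
    using \<phi>(1) by (simp add: cyclic_parametrization_def)
  \<comment> \<open>If two pairs of an exponent and an index name the same point, they still do
    after both indices are raised by 1, and conversely. The first direction makes \<open>z\<close>
    well defined, the second injective.\<close>
  have star2: "zpow g j (\<phi> c i) = zpow g j' (\<phi> c i') \<longleftrightarrow>
    zpow g j (\<phi> c (i + 1)) = zpow g j' (\<phi> c (i' + 1))" for c j i j' i'
    unfolding zpow_eq_iff [OF bij] by (rule star)
  have \<phi>_E: "E c (\<phi> c i)" for c i using \<phi>(2) by blast
  have coord: "\<exists>j i. w = zpow g j (\<phi> (rep w) i)" for w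
  proof -
    obtain j where "E (zpow g j (rep w)) w" using L_sym [OF L_rep] unfolding L_def by iprover
    then have "E (rep w) (zpow g (- j) w)"
      using invariant [of "zpow g j (rep w)" w "- j"] by (simp add: zpow_minus_cancel [OF bij])
    then obtain i where "zpow g (- j) w = \<phi> (rep w) i" using \<phi>(2) by blast
    then have "w = zpow g j (\<phi> (rep w) i)" by (metis zpow_cancel_minus [OF bij])
    then show ?thesis by blast
  qed
  have rep_\<phi>: "rep (zpow g j (\<phi> (rep w) i)) = rep w" for j i w
  proof -
    have "L (rep w) (zpow g j (\<phi> (rep w) i))"
      unfolding L_def using invariant [OF \<phi>_E] by blast
    from L_trans [OF L_rep this] have "L w (zpow g j (\<phi> (rep w) i))" .
    then show ?thesis by (rule rep_cong [symmetric])
  qed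
  obtain J I where JI: "w = zpow g (J w) (\<phi> (rep w) (I w))" for w
    using coord by metis
  define z where "z w = zpow g (J w) (\<phi> (rep w) (I w + 1))" for w
  \<comment> \<open>The coordinates \<open>J\<close> and \<open>I\<close> are arbitrary choices;
    \<open>star2\<close> shows that raising the index gives the same result for any other
    coordinates of the point.\<close>
  have z: "z (zpow g j (\<phi> (rep w) i)) = zpow g j (\<phi> (rep w) (i + 1))" for j w i
  proof -
    let ?v = "zpow g j (\<phi> (rep w) i)"
    have "zpow g (J ?v) (\<phi> (rep w) (I ?v)) = ?v"
      using JI [of ?v] by (simp only: rep_\<phi>)
    then have "zpow g (J ?v) (\<phi> (rep w) (I ?v + 1)) = zpow g j (\<phi> (rep w) (i + 1))"
      by (rule iffD1 [OF star2])
    then show ?thesis by (simp only: z_def rep_\<phi>)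
  qed
  have rep_z: "rep (z w) = rep w" for w
    by (simp only: z_def rep_\<phi>)
  have "bij z"
  proof (rule bijI)
    show "inj z"
    proof (rule injI)
      fix v w assume eq: "z v = z w"
      then have "rep v = rep w" using rep_z by metis
      with eq have "zpow g (J v) (\<phi> (rep w) (I v + 1)) = zpow g (J w) (\<phi> (rep w) (I w + 1))"
        by (simp add: z_def)
      then have "zpow g (J v) (\<phi> (rep v) (I v)) = zpow g (J w) (\<phi> (rep w) (I w))"
        unfolding \<open>rep v = rep w\<close> by (rule iffD2 [OF star2])
      then show "v = w" by (simp only: JI [symmetric])
    qed
    show "surj z"
    proof (rule surjI)
      fix w
      show "z (zpow g (J w) (\<phi> (rep w) (I w - 1))) = w"
        unfolding z using JI [of w, symmetric] by simp
    qed
  qed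
  \<comment> \<open>The map \<open>g\<close> raises the exponent and \<open>z\<close> raises the
    index, and these operations are independent.\<close>
  moreover have "z (g w) = g (z w)" for w
  proof -
    have g: "g (zpow g j x) = zpow g (j + 1) x" for j x
      by (simp add: zpow_Suc [OF bij])
    have "z (g (zpow g (J w) (\<phi> (rep w) (I w)))) = g (z w)"
      unfolding g z by (simp only: g z_def)
    then show ?thesis by (simp only: JI [symmetric])
  qed
  moreover have "same_orbit z = E"
  proof (intro ext)
    fix v w
    have z_pow: "zpow z n (zpow g j (\<phi> (rep v) i)) = zpow g j (\<phi> (rep v) (i + n))" for n j i
    proof (induction n rule: int_induct [of _ 0])
      case (step1 n)
      then show ?case by (simp add: zpow_Suc [OF \<open>bij z\<close>] z add.assoc)
    next
      case (step2 n)
      have "z (zpow g j (\<phi> (rep v) (i + (n - 1)))) = zpow g j (\<phi> (rep v) (i + n))"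
        using z [of j v "i + (n - 1)"] by simp
      then have "zpow g j (\<phi> (rep v) (i + (n - 1))) = inv_into UNIV z (zpow g j (\<phi> (rep v) (i + n)))"
        using \<open>bij z\<close> by (metis bij_is_inj inv_f_f)
      then show ?case using step2 by (simp only: zpow_diff_1 [OF \<open>bij z\<close>])
    qed simp
    have v: "zpow z n v = zpow g (J v) (\<phi> (rep v) (I v + n))" for n
      using z_pow [of n "J v" "I v"] by (simp only: JI [symmetric])
    \<comment> \<open>Translation by \<open>- J v\<close> moves the question to the representative
      block, which is the range of \<open>\<phi> (rep v)\<close>.\<close>
    have "E v w \<longleftrightarrow> E (rep v) (zpow g (- J v) w)"
    proof -
      have "E v w \<longleftrightarrow> E (zpow g (- J v) v) (zpow g (- J v) w)" by (rule invariant_iff [symmetric])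
      also have "zpow g (- J v) v = \<phi> (rep v) (I v)"
        using zpow_minus_cancel [OF bij, of "J v" "\<phi> (rep v) (I v)"] by (simp only: JI [symmetric])
      finally show ?thesis using \<phi>_E by (blast intro: E_sym E_trans)
    qed
    also have "\<dots> \<longleftrightarrow> (\<exists>i. zpow g (- J v) w = \<phi> (rep v) i)"
      using \<phi>(2) by blast
    also have "\<dots> \<longleftrightarrow> (\<exists>i. w = zpow g (J v) (\<phi> (rep v) i))"
    proof (intro ex_cong1 iffI)
      show "w = zpow g (J v) (\<phi> (rep v) i)" if "zpow g (- J v) w = \<phi> (rep v) i" for i
        unfolding that [symmetric] by (simp only: zpow_cancel_minus [OF bij])
    qed (simp only: zpow_minus_cancel [OF bij])
    also have "\<dots> \<longleftrightarrow> (\<exists>n. w = zpow z n v)"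
    proof
      assume "\<exists>i. w = zpow g (J v) (\<phi> (rep v) i)"
      then obtain i where "w = zpow g (J v) (\<phi> (rep v) i)" by (rule exE)
      then have "w = zpow z (i - I v) v" unfolding v by simp
      then show "\<exists>n. w = zpow z n v" by (rule exI)
    next
      assume "\<exists>n. w = zpow z n v"
      then show "\<exists>i. w = zpow g (J v) (\<phi> (rep v) i)" unfolding v by blast
    qed
    finally show "same_orbit z v w = E v w" by (simp add: same_orbit_def)
  qed
  ultimately show ?thesis by (rule that)
qed

end

section \<open>Refinements and joins of orbit relations\<close>

text \<open>This serves the meet. A block lies in one orbit of \<open>h\<close>, so it is countable,
  and its points are related by powers of \<open>h\<close>, which commute with \<open>g\<close> and
  so preserve stabilizers.\<close>

lemma invariant_equivalence_below_same_orbit: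
  assumes g: "bij g" and h: "bij h" and gh: "\<And>x. h (g x) = g (h x)"
    and E: "equivp E" "\<And>x y i. E x y \<Longrightarrow> E (zpow g i x) (zpow g i y)"
    and below: "\<And>x y. E x y \<Longrightarrow> same_orbit h x y"
  shows "invariant_equivalence g E"
proof
  show "zpow g i y = y" if "E x y" "zpow g i x = x" for x y i
  proof -
    obtain j where "y = zpow h j x" using below [OF \<open>E x y\<close>] unfolding same_orbit_def by (rule exE)
    then show ?thesis using zpow_commute2 [OF g h gh, of j i x] that(2) by simp
  qed
  show "countable (Collect (E x))" for x
    using countable_same_orbit [of h x] by (rule countable_subset [rotated]) (auto intro: below)
  show "(\<exists>F. finite F \<and> (\<forall>y. E x y \<longrightarrow> (\<exists>t\<in>F. same_orbit g t y))) \<or>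
    (\<forall>i. E (zpow g i x) x \<longrightarrow> zpow g i x = x)" for x
  proof (rule disjCI)
    assume "\<not> (\<forall>i. E (zpow g i x) x \<longrightarrow> zpow g i x = x)"
    then obtain i where i: "E (zpow g i x) x" "zpow g i x \<noteq> x" by blast
    from below [OF equivp_symp [OF E(1) i(1)]] obtain j where j: "zpow g i x = zpow h j x"
      unfolding same_orbit_def by (rule exE)
    with i have "j \<noteq> 0" by auto
    \<comment> \<open>These points cover all residues modulo \<open>j\<close>. The interval is
      symmetric because \<open>mod\<close> takes the sign of \<open>j\<close>, which may be
      negative.\<close>
    let ?F = "(\<lambda>r. zpow h r x) ` {- \<bar>j\<bar>..\<bar>j\<bar>}"
    have "\<exists>t\<in>?F. same_orbit g t y" if "E x y" for y
    proof -
      from below [OF that] obtain l where l: "y = zpow h l x"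
        unfolding same_orbit_def by (rule exE)
      \<comment> \<open>Split \<open>l\<close> by division by \<open>j\<close>; the multiple of
        \<open>j\<close> acts on \<open>x\<close> as a power of \<open>g\<close>, so only the
        remainder matters for the \<open>g\<close>-orbit.\<close>
      have "y = zpow h (l mod j) (zpow h (j * (l div j)) x)"
        using zpow_add [OF h, of "l mod j" "j * (l div j)" x] l by simp
      also have "\<dots> = zpow h (l mod j) (zpow g (i * (l div j)) x)"
        using zpow_cong_mult [OF g h gh j] by simp
      also have "\<dots> = zpow g (i * (l div j)) (zpow h (l mod j) x)"
        by (rule zpow_commute2 [OF g h gh])
      finally have "same_orbit g (zpow h (l mod j) x) y" unfolding same_orbit_def by (rule exI)
      moreover have "l mod j \<in> {- \<bar>j\<bar>..\<bar>j\<bar>}"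
        using abs_mod_less [OF \<open>j \<noteq> 0\<close>, of l] by auto
      ultimately show ?thesis by blast
    qed
    then show "\<exists>F. finite F \<and> (\<forall>y. E x y \<longrightarrow> (\<exists>t\<in>F. same_orbit g t y))"
      by (intro exI [of _ ?F]) simp
  qed
qed (use assms in auto)

lemma zpow_same_orbit:
  assumes g: "bij g" and h: "bij h" and gh: "\<And>x. h (g x) = g (h x)" and "same_orbit h x y"
  shows "same_orbit h (zpow g i x) (zpow g i y)"
proof -
  obtain j where "y = zpow h j x" using assms(4) unfolding same_orbit_def by (rule exE)
  then have "zpow g i y = zpow h j (zpow g i x)" by (simp add: zpow_commute2 [OF g h gh])
  then show ?thesis unfolding same_orbit_def by (rule exI)
qed

section \<open>Transport along commuting bijections and the join\<close>

lemma bij_zpow: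
  assumes "bij f" shows "bij (zpow f i)"
  by (rule bij_betw_byWitness [of _ "zpow f (- i)"])
    (simp_all add: zpow_minus_cancel [OF assms] zpow_cancel_minus [OF assms])

lemma ecard_image: "inj_on f A \<Longrightarrow> ecard (f ` A) = ecard A"
  by (simp add: ecard_def finite_image_iff card_image)

lemma ecard_eq_1D:
  assumes "ecard A = 1" obtains x where "A = {x}"
  using assms by (auto simp: ecard_def one_enat_def card_1_singleton_iff split: if_splits)

text \<open>Points of one block are related by bijections commuting with \<open>g\<close>, namely
  products of powers of \<open>h\<close> and \<open>k\<close>. These preserve both stabilizers in
  the powers of \<open>g\<close> and sizes of \<open>g\<close>-orbits.\<close>

lemma invariant_equivalence_join:
  fixes g h k :: "'a \<Rightarrow> 'a"
  assumes g: "bij g" and h: "bij h" and k: "bij k"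
    and gh: "\<And>x. h (g x) = g (h x)" and gk: "\<And>x. k (g x) = g (k x)"
    and fin: "\<And>n. n \<noteq> 1 \<Longrightarrow> finite {B. (\<exists>x. B = Collect (same_orbit g x)) \<and> ecard B = n}"
  shows "invariant_equivalence g (sup (same_orbit h) (same_orbit k))\<^sup>*\<^sup>*"
    (is "invariant_equivalence g ?R\<^sup>*\<^sup>*")
proof -
  note so = same_orbit_equivp [OF h] same_orbit_equivp [OF k]
  have transport: "\<exists>w. bij w \<and> (\<forall>x. w (g x) = g (w x)) \<and> b = w a" if "?R\<^sup>*\<^sup>* a b" for a b
    using that
  proof (induction rule: rtranclp_induct)
    case base
    show ?case by (rule exI [of _ "\<lambda>x. x"]) (simp add: bij_id [unfolded id_def])
  next
    case (step b c)
    then obtain w where w: "bij w" "\<And>x. w (g x) = g (w x)" "b = w a" by blast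
    obtain v where v: "bij v" "\<And>x. v (g x) = g (v x)" "c = v b"
    proof -
      from step(2) consider i where "c = zpow h i b" | i where "c = zpow k i b"
        by (auto simp: same_orbit_def)
      then show thesis
      proof cases
        case 1
        with that [of "zpow h i"] show thesis
          using bij_zpow [OF h] zpow_commute [OF h, of g] gh by metis
      next
        case 2
        with that [of "zpow k i"] show thesis
          using bij_zpow [OF k] zpow_commute [OF k, of g] gk by metis
      qed
    qed
    show ?case
      using bij_comp [OF w(1) v(1)] by (intro exI [of _ "v \<circ> w"]) (simp add: w v comp_def)
  qed
  have equiv: "equivp ?R\<^sup>*\<^sup>*"
  proof (rule equivpI)
    have "symp ?R" using so by (auto intro!: sympI dest: equivp_symp)
    then show "symp ?R\<^sup>*\<^sup>*" by (rule symp_rtranclp)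
  qed (auto intro: reflpI transpI)
  show ?thesis
  proof
    show "bij g" "equivp ?R\<^sup>*\<^sup>*" by fact+
    show "?R\<^sup>*\<^sup>* (zpow g i a) (zpow g i b)" if "?R\<^sup>*\<^sup>* a b" for a b i
      using that
    proof (induction rule: rtranclp_induct)
      case (step b c)
      have "?R (zpow g i b) (zpow g i c)"
        using step(2) zpow_same_orbit [OF g h gh] zpow_same_orbit [OF g k gk] by auto
      with step(3) show ?case by (rule rtranclp.rtrancl_into_rtrancl)
    qed simp
    show fixed: "zpow g i b = b" if "?R\<^sup>*\<^sup>* a b" "zpow g i a = a" for a b i
    proof -
      obtain w where w: "bij w" "\<And>x. w (g x) = g (w x)" "b = w a"
        using transport [OF \<open>?R\<^sup>*\<^sup>* a b\<close>] by blast
      then show ?thesis using zpow_commute [where h = w, OF g w(2), of i a] that(2) by simp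
    qed
    show "countable (Collect (?R\<^sup>*\<^sup>* a))" for a
    proof -
      \<comment> \<open>Each step leads from a countable set to a countable set, since orbits of
        \<open>h\<close> and \<open>k\<close> are countable; hence so does the closure.\<close>
      let ?X = "{(x, y). ?R x y}"
      have "countable (?X\<^sup>* `` {a})"
      proof (rule countable_rtrancl)
        fix Y :: "'a set" assume "countable Y"
        have "?X `` Y = (\<Union>x\<in>Y. Collect (same_orbit h x) \<union> Collect (same_orbit k x))"
          by auto
        then show "countable (?X `` Y)"
          using \<open>countable Y\<close> by (simp add: countable_same_orbit)
      qed simp
      also have "?X\<^sup>* `` {a} = Collect (?R\<^sup>*\<^sup>* a)"
        by (simp add: Image_def rtranclp_rtrancl_eq [symmetric] del: sup_apply)
      finally show ?thesis .
    qed
    show "(\<exists>F. finite F \<and> (\<forall>b. ?R\<^sup>*\<^sup>* a b \<longrightarrow> (\<exists>t\<in>F. same_orbit g t b))) \<or>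
      (\<forall>i. ?R\<^sup>*\<^sup>* (zpow g i a) a \<longrightarrow> zpow g i a = a)" for a
    proof (cases "ecard (Collect (same_orbit g a)) = 1")
      case True
      then obtain c where c: "Collect (same_orbit g a) = {c}" by (rule ecard_eq_1D)
      have c: "zpow g i a = c" for i
      proof -
        have "zpow g i a \<in> Collect (same_orbit g a)" unfolding same_orbit_def by blast
        then show ?thesis unfolding c by simp
      qed
      have "zpow g i a = a" for i
        using c [of i] c [of 0] by (simp only: zpow_0)
      then show ?thesis by blast
    next
      case False
      let ?B = "{B. (\<exists>x. B = Collect (same_orbit g x)) \<and> ecard B = ecard (Collect (same_orbit g a))}"
      \<comment> \<open>One point is chosen from each \<open>g\<close>-orbit of the same size as
        that of \<open>a\<close>; by hypothesis these orbits are finite in number.\<close>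
      let ?F = "(\<lambda>B. SOME t. t \<in> B) ` ?B"
      have "\<exists>t\<in>?F. same_orbit g t b" if "?R\<^sup>*\<^sup>* a b" for b
      proof -
        from transport [OF that] obtain w where w: "bij w" "\<And>x. w (g x) = g (w x)" "b = w a"
          by blast
        have "Collect (same_orbit g b) = w ` Collect (same_orbit g a)"
          unfolding same_orbit_def w(3) zpow_commute [where h = w, OF g w(2), symmetric] by blast
        moreover have "inj_on w (Collect (same_orbit g a))"
          using bij_is_inj [OF w(1)] by (rule inj_on_subset) simp
        ultimately have "ecard (Collect (same_orbit g b)) = ecard (Collect (same_orbit g a))"
          by (simp only: ecard_image)
        then have "(SOME t. t \<in> Collect (same_orbit g b)) \<in> ?F"
          by (intro imageI CollectI conjI exI [of _ b] refl)
        moreover have "(SOME t. t \<in> Collect (same_orbit g b)) \<in> Collect (same_orbit g b)"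
          by (rule someI [of _ b]) (simp add: equivp_reflp [OF same_orbit_equivp [OF g]])
        then have "same_orbit g (SOME t. t \<in> Collect (same_orbit g b)) b"
          unfolding mem_Collect_eq by (rule equivp_symp [OF same_orbit_equivp [OF g]])
        ultimately show ?thesis by (rule bexI [rotated])
      qed
      moreover have "finite ?F" using fin [OF False] by simp
      ultimately show ?thesis by blast
    qed
  qed
qed

section \<open>Lattice operations on blocks of equivalence relations\<close>

definition blocks :: "'a set \<Rightarrow> ('a \<Rightarrow> 'a \<Rightarrow> bool) \<Rightarrow> 'a set set"
  where "blocks \<Omega> E = (\<lambda>x. Collect (E x)) ` \<Omega>"

text \<open>An equivalence on \<Omega> is encoded as a relation on the whole type that is the
  identity outside \<Omega>. Thus \<open>inf\<close>, \<open>sup\<close> and transitive closure need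
  no relativization.\<close>

definition equivalence_within :: "'a set \<Rightarrow> ('a \<Rightarrow> 'a \<Rightarrow> bool) \<Rightarrow> bool"
  where "equivalence_within \<Omega> E \<longleftrightarrow> equivp E \<and> (\<forall>x y. E x y \<longrightarrow> x \<notin> \<Omega> \<longrightarrow> y = x)"

lemma equivalence_withinD:
  assumes "equivalence_within \<Omega> E"
  shows "E x x" "E x y \<Longrightarrow> E y x" "E x y \<Longrightarrow> E y w \<Longrightarrow> E x w"
    "E x y \<Longrightarrow> x \<notin> \<Omega> \<Longrightarrow> y = x" "E x y \<Longrightarrow> x \<in> \<Omega> \<Longrightarrow> y \<in> \<Omega>"
proof -
  have E: "equivp E" and triv: "\<And>x y. E x y \<Longrightarrow> x \<notin> \<Omega> \<Longrightarrow> y = x"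
    using assms unfolding equivalence_within_def by blast+
  show "E x x" by (rule equivp_reflp [OF E])
  show sym: "E x y \<Longrightarrow> E y x" by (rule equivp_symp [OF E])
  show "E x y \<Longrightarrow> E y w \<Longrightarrow> E x w" by (rule equivp_transp [OF E])
  show "E x y \<Longrightarrow> x \<notin> \<Omega> \<Longrightarrow> y = x" by (rule triv)
  show "E x y \<Longrightarrow> x \<in> \<Omega> \<Longrightarrow> y \<in> \<Omega>"
    using sym triv [of y x] by auto
qed

lemma Collect_equivalence_eq:
  assumes "equivalence_within \<Omega> E" "E x y" shows "Collect (E x) = Collect (E y)"
  using equivalence_withinD (2,3) [OF assms(1)] assms(2) by blast

lemma partition_on_blocks:
  assumes "equivalence_within \<Omega> E" shows "partition_on \<Omega> (blocks \<Omega> E)"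
proof (rule partition_onI)
  note E = equivalence_withinD [OF assms]
  show "\<Union> (blocks \<Omega> E) = \<Omega>" using E(1,5) by (auto simp: blocks_def)
  show "{} \<notin> blocks \<Omega> E" using E(1) by (auto simp: blocks_def)
  fix p q assume "p \<in> blocks \<Omega> E" "q \<in> blocks \<Omega> E" and ne: "p \<noteq> q"
  then obtain x y where p: "p = Collect (E x)" and q: "q = Collect (E y)"
    by (auto simp: blocks_def)
  have False if "E x w" "E y w" for w
    using Collect_equivalence_eq [OF assms that(1)] Collect_equivalence_eq [OF assms that(2)] ne p q by simp
  then show "disjnt p q" by (auto simp: p q disjnt_def)
qed

text \<open>A non-empty intersection of two classes is the class under \<open>inf E F\<close> of any
  of its points.\<close>

lemma meet_blocks:
  assumes E: "equivalence_within \<Omega> E" and F: "equivalence_within \<Omega> F"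
  shows "blocks \<Omega> E \<sqinter>\<^bsub>partition_order \<Omega>\<^esub> blocks \<Omega> F = blocks \<Omega> (inf E F)"
  unfolding meet_partition_order [OF E [THEN partition_on_blocks] F [THEN partition_on_blocks]]
proof (intro equalityI subsetI)
  fix X assume "X \<in> {A \<inter> B |A B. A \<in> blocks \<Omega> E \<and> B \<in> blocks \<Omega> F} - {{}}"
  then obtain x y w where X: "X = Collect (E x) \<inter> Collect (F y)" "x \<in> \<Omega>" and w: "E x w" "F y w"
    by (auto simp: blocks_def)
  have "X = Collect (inf E F w)"
    unfolding X(1) Collect_equivalence_eq [OF E w(1)] Collect_equivalence_eq [OF F w(2)] by auto
  moreover have "w \<in> \<Omega>" using equivalence_withinD (5) [OF E w(1) X(2)] .
  ultimately show "X \<in> blocks \<Omega> (inf E F)" by (auto simp: blocks_def)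
next
  fix X assume "X \<in> blocks \<Omega> (inf E F)"
  then obtain x where x: "x \<in> \<Omega>" "X = Collect (inf E F x)" by (auto simp: blocks_def)
  then have "X = Collect (E x) \<inter> Collect (F x)" by auto
  moreover have "x \<in> X"
    using equivalence_withinD (1) [OF E] equivalence_withinD (1) [OF F] by (simp add: x)
  ultimately show "X \<in> {A \<inter> B |A B. A \<in> blocks \<Omega> E \<and> B \<in> blocks \<Omega> F} - {{}}"
    using x(1) unfolding blocks_def by blast
qed

section \<open>Joins as transitive closures\<close>

lemma equivalence_within_join:
  assumes E: "equivalence_within \<Omega> E" and F: "equivalence_within \<Omega> F"
  shows "equivalence_within \<Omega> (sup E F)\<^sup>*\<^sup>*"
proof -
  note D = equivalence_withinD [OF E] equivalence_withinD [OF F]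
  have "y = x" if "(sup E F)\<^sup>*\<^sup>* x y" "x \<notin> \<Omega>" for x y
    using that by (induction rule: rtranclp_induct) (auto dest: D(4,9))
  moreover have "equivp (sup E F)\<^sup>*\<^sup>*"
  proof (rule equivpI)
    have "symp (sup E F)" using D(2,7) by (auto intro!: sympI)
    then show "symp (sup E F)\<^sup>*\<^sup>*" by (rule symp_rtranclp)
  qed (auto intro: reflpI transpI)
  ultimately show ?thesis unfolding equivalence_within_def by blast
qed

lemma join_blocks:
  assumes E: "equivalence_within \<Omega> E" and F: "equivalence_within \<Omega> F"
  shows "blocks \<Omega> E \<squnion>\<^bsub>partition_order \<Omega>\<^esub> blocks \<Omega> F = blocks \<Omega> (sup E F)\<^sup>*\<^sup>*"
proof -
  interpret partial_order "partition_order \<Omega>"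
    by (rule partial_order_partition_order)
  let ?J = "(sup E F)\<^sup>*\<^sup>*"
  note P = E [THEN partition_on_blocks] F [THEN partition_on_blocks]
    equivalence_within_join [OF E F, THEN partition_on_blocks]
  have "Collect (E x) \<subseteq> Collect (?J x)" "Collect (F x) \<subseteq> Collect (?J x)" for x
    by auto
  then have "refines \<Omega> (blocks \<Omega> E) (blocks \<Omega> ?J)" "refines \<Omega> (blocks \<Omega> F) (blocks \<Omega> ?J)"
    using P unfolding refines_def blocks_def by blast+
  then have upper: "blocks \<Omega> ?J \<in> Upper (partition_order \<Omega>) {blocks \<Omega> E, blocks \<Omega> F}"
    using P by (auto simp: Upper_def)
  have "refines \<Omega> (blocks \<Omega> ?J) R"
    if "R \<in> Upper (partition_order \<Omega>) {blocks \<Omega> E, blocks \<Omega> F}" for R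
  proof -
    have R: "refines \<Omega> (blocks \<Omega> E) R" "refines \<Omega> (blocks \<Omega> F) R"
      using that P by (auto simp: Upper_def)
    then have pR: "partition_on \<Omega> R" by (simp add: refines_def)
    \<comment> \<open>Parts of a common coarsening are closed under both relations, because two
      parts sharing \<open>y\<close> coincide. Induction along a path then puts the whole joined
      class into one part.\<close>
    have step: "w \<in> Y" if "Y \<in> R" "y \<in> Y" "sup E F y w" for y w Y
    proof -
      have "y \<in> \<Omega>" using that(1,2) pR by (auto simp: partition_on_def)
      obtain Z where "Z \<in> R" "y \<in> Z" "w \<in> Z"
      proof (cases "E y w")
        case True
        have "Collect (E y) \<in> blocks \<Omega> E" using \<open>y \<in> \<Omega>\<close> by (simp add: blocks_def)
        with R(1) obtain Z where "Z \<in> R" "Collect (E y) \<subseteq> Z" unfolding refines_def by blast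
        with True equivalence_withinD (1) [OF E] show thesis by (intro that [of Z]) auto
      next
        case False
        have "Collect (F y) \<in> blocks \<Omega> F" using \<open>y \<in> \<Omega>\<close> by (simp add: blocks_def)
        with R(2) obtain Z where "Z \<in> R" "Collect (F y) \<subseteq> Z" unfolding refines_def by blast
        with False \<open>sup E F y w\<close> equivalence_withinD (1) [OF F] show thesis
          by (intro that [of Z]) auto
      qed
      moreover have "Z = Y"
        using pR \<open>Z \<in> R\<close> \<open>Y \<in> R\<close> \<open>y \<in> Z\<close> \<open>y \<in> Y\<close> unfolding partition_on_def disjoint_def by blast
      ultimately show ?thesis by simp
    qed
    have "\<exists>Y\<in>R. Collect (?J x) \<subseteq> Y" if "x \<in> \<Omega>" for x
    proof -
      obtain Y where Y: "Y \<in> R" "x \<in> Y" using pR \<open>x \<in> \<Omega>\<close> unfolding partition_on_def by blast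
      have "y \<in> Y" if "?J x y" for y
        using that by (induction rule: rtranclp_induct) (use Y step in blast)+
      with Y show ?thesis by blast
    qed
    then show ?thesis using pR P(3) unfolding refines_def by (auto simp: blocks_def)
  qed
  with upper have *: "least (partition_order \<Omega>) (blocks \<Omega> ?J)
      (Upper (partition_order \<Omega>) {blocks \<Omega> E, blocks \<Omega> F})"
    unfolding least_def using Upper_closed by fastforce
  then have "least (partition_order \<Omega>) (blocks \<Omega> E \<squnion>\<^bsub>partition_order \<Omega>\<^esub> blocks \<Omega> F)
      (Upper (partition_order \<Omega>) {blocks \<Omega> E, blocks \<Omega> F})"
    unfolding join_def sup_def by (rule someI)
  with * show ?thesis by (rule least_unique [rotated])
qed

section \<open>Orbit partitions of centralizers\<close>

text \<open>Elements of \<open>BijGroup \<Omega>\<close> are undefined outside \<open>\<Omega>\<close>; they are made total by fixing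
  the points there.\<close>

definition total_ext :: "'a set \<Rightarrow> ('a \<Rightarrow> 'a) \<Rightarrow> 'a \<Rightarrow> 'a"
  where "total_ext \<Omega> h x = (if x \<in> \<Omega> then h x else x)"

lemma bij_total_ext:
  assumes "h \<in> carrier (BijGroup \<Omega>)" shows "bij (total_ext \<Omega> h)"
proof -
  have "bij_betw h \<Omega> \<Omega>" using assms by (simp add: BijGroup_def Bij_def)
  then have "bij_betw (total_ext \<Omega> h) \<Omega> \<Omega>"
    by (rule iffD1 [OF bij_betw_cong, rotated]) (simp add: total_ext_def)
  moreover have "bij_betw (total_ext \<Omega> h) (- \<Omega>) (- \<Omega>)"
    by (rule iffD1 [OF bij_betw_cong, rotated, OF bij_betw_id]) (simp add: total_ext_def)
  ultimately have "bij_betw (total_ext \<Omega> h) (\<Omega> \<union> - \<Omega>) (\<Omega> \<union> - \<Omega>)"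
    by (rule bij_betw_combine) simp
  then show ?thesis by simp
qed

lemma BijGroup_mult_apply:
  assumes "h \<in> carrier (BijGroup \<Omega>)" "k \<in> carrier (BijGroup \<Omega>)" "x \<in> \<Omega>"
  shows "(h \<otimes>\<^bsub>BijGroup \<Omega>\<^esub> k) x = h (k x)"
  using assms by (simp add: BijGroup_def compose_def)

lemma BijGroup_apply_mem:
  assumes "h \<in> carrier (BijGroup \<Omega>)" "x \<in> \<Omega>" shows "h x \<in> \<Omega>"
  using assms by (auto simp: BijGroup_def dest: Bij_imp_funcset)

text \<open>This links group powers to \<open>zpow\<close>. The downward induction step applies
  \<open>total_ext \<Omega> h\<close> to both sides and cancels it by injectivity.\<close>

lemma int_pow_BijGroup_apply:
  assumes h: "h \<in> carrier (BijGroup \<Omega>)" and x: "x \<in> \<Omega>"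
  shows "(h [^]\<^bsub>BijGroup \<Omega>\<^esub> (i::int)) x = zpow (total_ext \<Omega> h) i x"
proof -
  interpret group "BijGroup \<Omega>" by (rule group_BijGroup)
  note bij = bij_total_ext [OF h]
  have step: "(h [^]\<^bsub>BijGroup \<Omega>\<^esub> (i + 1)) x = total_ext \<Omega> h ((h [^]\<^bsub>BijGroup \<Omega>\<^esub> i) x)" for i :: int
  proof -
    have "h [^]\<^bsub>BijGroup \<Omega>\<^esub> (i + 1) = h \<otimes>\<^bsub>BijGroup \<Omega>\<^esub> h [^]\<^bsub>BijGroup \<Omega>\<^esub> i"
      using int_pow_mult [OF h, of 1 i] h by (simp add: add.commute)
    then show ?thesis
      using BijGroup_mult_apply [OF h int_pow_closed [OF h] x] BijGroup_apply_mem [OF int_pow_closed [OF h] x]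
      by (simp add: total_ext_def)
  qed
  show ?thesis
  proof (induction i rule: int_induct [of _ 0])
    case base
    show ?case using x by (simp add: BijGroup_def)
  next
    case (step1 i)
    then show ?case by (simp add: step zpow_Suc [OF bij])
  next
    case (step2 i)
    have "total_ext \<Omega> h ((h [^]\<^bsub>BijGroup \<Omega>\<^esub> (i - 1)) x) = total_ext \<Omega> h (zpow (total_ext \<Omega> h) (i - 1) x)"
      using step [of "i - 1"] zpow_Suc [OF bij, of "i - 1" x] step2 by simp
    then show ?case by (simp add: inj_eq [OF bij_is_inj [OF bij]])
  qed
qed

text \<open>The subgroup generated by \<open>h\<close> is the same inside \<open>C\<close> as in the
  full group, where it consists of the integer powers of \<open>h\<close>.\<close>

lemma orbit_partition_eq_blocks:
  assumes C: "subgroup C (BijGroup \<Omega>)" and h: "h \<in> C"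
  shows "orbit_partition (BijGroup \<Omega>\<lparr>carrier := C\<rparr>) \<Omega> (\<lambda>h. h) h =
    blocks \<Omega> (same_orbit (total_ext \<Omega> h))"
proof -
  interpret group "BijGroup \<Omega>" by (rule group_BijGroup)
  have hG: "h \<in> carrier (BijGroup \<Omega>)" using subgroup.mem_carrier [OF C h] .
  have "carrier (subgroup_generated (BijGroup \<Omega>\<lparr>carrier := C\<rparr>) {h}) =
      generate (BijGroup \<Omega>\<lparr>carrier := C\<rparr>) {h}"
    using h by (simp add: carrier_subgroup_generated)
  also have "\<dots> = {h [^]\<^bsub>BijGroup \<Omega>\<^esub> (i::int) |i. i \<in> UNIV}"
    using generate_consistent [OF _ C, of "{h}"] h generate_pow [OF hG] by simp
  finally have "orbit (subgroup_generated (BijGroup \<Omega>\<lparr>carrier := C\<rparr>) {h}) (\<lambda>h. h) x =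
      Collect (same_orbit (total_ext \<Omega> h) x)" if "x \<in> \<Omega>" for x
    using int_pow_BijGroup_apply [OF hG that, symmetric] unfolding orbit_def same_orbit_def by auto
  then show ?thesis
    unfolding orbit_partition_def orbits_def blocks_def by auto
qed

lemma total_ext_outside: "x \<notin> \<Omega> \<Longrightarrow> total_ext \<Omega> h x = x"
  by (simp add: total_ext_def)

lemma equivalence_within_same_orbit:
  assumes "h \<in> carrier (BijGroup \<Omega>)" shows "equivalence_within \<Omega> (same_orbit (total_ext \<Omega> h))"
proof -
  note bij = bij_total_ext [OF assms]
  have "zpow (total_ext \<Omega> h) i x = x" if "x \<notin> \<Omega>" for i x
    using zpow_fixed [OF bij, of 1 x i] that by (simp add: total_ext_outside)
  then show ?thesis
    using same_orbit_equivp [OF bij] by (auto simp: equivalence_within_def same_orbit_def)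
qed

lemma centralizer_total_ext:
  assumes g: "g \<in> carrier (BijGroup \<Omega>)" and h: "h \<in> centralizer (BijGroup \<Omega>) g"
  shows "total_ext \<Omega> h (total_ext \<Omega> g x) = total_ext \<Omega> g (total_ext \<Omega> h x)"
proof (cases "x \<in> \<Omega>")
  case True
  have hG: "h \<in> carrier (BijGroup \<Omega>)" and eq: "h \<otimes>\<^bsub>BijGroup \<Omega>\<^esub> g = g \<otimes>\<^bsub>BijGroup \<Omega>\<^esub> h"
    using h by (auto simp: centralizer_def)
  have "h (g x) = g (h x)"
    using BijGroup_mult_apply [OF hG g True] BijGroup_mult_apply [OF g hG True] eq by simp
  then show ?thesis
    using True BijGroup_apply_mem [OF hG True] BijGroup_apply_mem [OF g True] by (simp add: total_ext_def)
qed (simp add: total_ext_outside)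

text \<open>The realizing bijection \<open>z\<close> moves points only within blocks of
  \<open>E\<close>. Hence it fixes everything outside \<Omega> and restricts to an element of the
  centralizer.\<close>

lemma blocks_mem_orbit_partitions:
  assumes g: "g \<in> carrier (BijGroup \<Omega>)"
    and E: "invariant_equivalence (total_ext \<Omega> g) E" "equivalence_within \<Omega> E"
  shows "blocks \<Omega> E \<in>
    orbit_partitions (BijGroup \<Omega>\<lparr>carrier := centralizer (BijGroup \<Omega>) g\<rparr>) \<Omega> (\<lambda>h. h)"
proof -
  obtain z where z: "bij z" "\<And>x. z (total_ext \<Omega> g x) = total_ext \<Omega> g (z x)" "same_orbit z = E"
    using invariant_equivalence.commuting_bijection_with_orbits [OF E(1)] by blast
  have Ez: "E x (z x)" for x
    unfolding z(3) [symmetric] same_orbit_def by (rule exI [of _ 1]) simp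
  have out: "z x = x" if "x \<notin> \<Omega>" for x using equivalence_withinD (4) [OF E(2) Ez that] .
  have mem: "z x \<in> \<Omega> \<longleftrightarrow> x \<in> \<Omega>" for x
    using equivalence_withinD (5) [OF E(2) Ez] out by (cases "x \<in> \<Omega>") auto
  \<comment> \<open>Elements of \<open>BijGroup \<Omega>\<close> are extensional, so
    \<open>z\<close> is made undefined outside \<Omega>; \<open>total_ext\<close> then recovers
    \<open>z\<close>.\<close>
  define h where "h = restrict z \<Omega>"
  have total_ext_h: "total_ext \<Omega> h = z"
    by (rule ext) (simp add: total_ext_def h_def out)
  have "bij_betw z \<Omega> \<Omega>"
  proof (rule bij_betw_imageI)
    show "inj_on z \<Omega>" using z(1) by (auto simp: bij_def intro: inj_on_subset)
    show "z ` \<Omega> = \<Omega>"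
    proof (intro equalityI subsetI)
      fix y assume "y \<in> \<Omega>"
      obtain x where "y = z x" using bij_is_surj [OF z(1)] by (rule surjE)
      with \<open>y \<in> \<Omega>\<close> mem show "y \<in> z ` \<Omega>" by blast
    qed (use mem in blast)
  qed
  then have hG: "h \<in> carrier (BijGroup \<Omega>)"
    by (simp add: BijGroup_def Bij_def h_def bij_betw_restrict_eq)
  have gx: "g x \<in> \<Omega>" if "x \<in> \<Omega>" for x using BijGroup_apply_mem [OF g that] .
  have "z (g x) = g (z x)" if "x \<in> \<Omega>" for x
    using z(2) [of x] that mem by (simp add: total_ext_def)
  then have "compose \<Omega> h g = compose \<Omega> g h"
    using gx by (intro ext) (simp add: compose_def h_def mem)
  then have hC: "h \<in> centralizer (BijGroup \<Omega>) g"
    using hG g by (simp add: centralizer_def BijGroup_def)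
  have "orbit_partition (BijGroup \<Omega>\<lparr>carrier := centralizer (BijGroup \<Omega>) g\<rparr>) \<Omega> (\<lambda>h. h) h = blocks \<Omega> E"
    using orbit_partition_eq_blocks [OF subgroup_centralizer [OF group_BijGroup g] hC]
    by (simp add: total_ext_h z(3))
  with hC show ?thesis unfolding orbit_partitions_def by force
qed

text \<open>Points outside \<Omega> are fixed by \<open>total_ext \<Omega> g\<close> and contribute
  only orbits of size 1, so the counts for other sizes agree with those on \<Omega>.\<close>

lemma finite_orbits_total_ext:
  assumes g: "g \<in> carrier (BijGroup \<Omega>)" and "n \<noteq> 1"
    and fin: "orbit_count (BijGroup \<Omega>) \<Omega> (\<lambda>h. h) g n \<noteq> \<infinity>"
  shows "finite {B. (\<exists>x. B = Collect (same_orbit (total_ext \<Omega> g) x)) \<and> ecard B = n}"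
proof -
  have eq: "orbit_partition (BijGroup \<Omega>) \<Omega> (\<lambda>h. h) g = blocks \<Omega> (same_orbit (total_ext \<Omega> g))"
    using orbit_partition_eq_blocks [OF group.subgroup_self [OF group_BijGroup] g] by simp
  have "finite {B \<in> blocks \<Omega> (same_orbit (total_ext \<Omega> g)). ecard B = n}"
    using fin by (auto simp: orbit_count_def eq ecard_def [of "{B \<in> _. _ B}"] split: if_splits)
  moreover have "x \<in> \<Omega>" if "ecard (Collect (same_orbit (total_ext \<Omega> g) x)) = n" for x
  proof (rule ccontr)
    assume "x \<notin> \<Omega>"
    with equivalence_withinD (1,4) [OF equivalence_within_same_orbit [OF g]]
    have "Collect (same_orbit (total_ext \<Omega> g) x) = {x}" by blast
    with that \<open>n \<noteq> 1\<close> show False by (simp add: ecard_def one_enat_def)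
  qed
  then have "{B. (\<exists>x. B = Collect (same_orbit (total_ext \<Omega> g) x)) \<and> ecard B = n} \<subseteq>
      {B \<in> blocks \<Omega> (same_orbit (total_ext \<Omega> g)). ecard B = n}"
    by (auto simp: blocks_def)
  ultimately show ?thesis by (rule finite_subset [rotated])
qed

theorem theorem3:
  fixes \<Omega> :: "'a set" and g :: "'a \<Rightarrow> 'a"
  assumes "g \<in> carrier (BijGroup \<Omega>)"
  shows "meet_coherent (BijGroup \<Omega>\<lparr>carrier := centralizer (BijGroup \<Omega>) g\<rparr>) \<Omega> (\<lambda>h. h) \<and>
    ((\<forall>k. k \<noteq> 1 \<longrightarrow> orbit_count (BijGroup \<Omega>) \<Omega> (\<lambda>h. h) g k \<noteq> \<infinity>) \<longrightarrow>
      join_coherent (BijGroup \<Omega>\<lparr>carrier := centralizer (BijGroup \<Omega>) g\<rparr>) \<Omega> (\<lambda>h. h))"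
proof -
  let ?C = "centralizer (BijGroup \<Omega>) g"
  let ?H = "BijGroup \<Omega>\<lparr>carrier := ?C\<rparr>"
  let ?so = "\<lambda>h. same_orbit (total_ext \<Omega> h)"
  note subgroup = subgroup_centralizer [OF group_BijGroup assms]
  note bij = bij_total_ext [OF subgroup.mem_carrier [OF subgroup]]
  note commute = centralizer_total_ext [OF assms]
  note bij_g = bij_total_ext [OF assms]
  have within: "equivalence_within \<Omega> (?so h)" if "h \<in> ?C" for h
    using equivalence_within_same_orbit subgroup.mem_carrier [OF subgroup that] .
  have partitions: "orbit_partitions ?H \<Omega> (\<lambda>h. h) = (\<lambda>h. blocks \<Omega> (?so h)) ` ?C"
    using orbit_partition_eq_blocks [OF subgroup] unfolding orbit_partitions_def by auto
  have "blocks \<Omega> (?so h) \<sqinter>\<^bsub>partition_order \<Omega>\<^esub> blocks \<Omega> (?so k) \<in> orbit_partitions ?H \<Omega> (\<lambda>h. h)"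
    if h: "h \<in> ?C" and k: "k \<in> ?C" for h k
    unfolding meet_blocks [OF within [OF h] within [OF k]]
  proof (rule blocks_mem_orbit_partitions [OF assms])
    note D = equivalence_withinD [OF within [OF h]] equivalence_withinD [OF within [OF k]]
    have equiv: "equivp (inf (?so h) (?so k))"
      by (intro equivpI reflpI sympI transpI) (auto intro: D(1,2,3,6,7,8))
    then show "equivalence_within \<Omega> (inf (?so h) (?so k))"
      using D(4) by (auto simp: equivalence_within_def)
    show "invariant_equivalence (total_ext \<Omega> g) (inf (?so h) (?so k))"
      \<comment> \<open>The meet refines the orbits of \<open>h\<close>, and is invariant since both
        orbit relations are.\<close>
      by (rule invariant_equivalence_below_same_orbit [OF bij_g bij [OF h] commute [OF h] equiv])
        (auto intro: zpow_same_orbit [OF bij_g bij [OF h] commute [OF h]]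
          zpow_same_orbit [OF bij_g bij [OF k] commute [OF k]])
  qed
  moreover have "blocks \<Omega> (?so h) \<squnion>\<^bsub>partition_order \<Omega>\<^esub> blocks \<Omega> (?so k) \<in> orbit_partitions ?H \<Omega> (\<lambda>h. h)"
    if fin: "\<forall>k. k \<noteq> 1 \<longrightarrow> orbit_count (BijGroup \<Omega>) \<Omega> (\<lambda>h. h) g k \<noteq> \<infinity>"
      and h: "h \<in> ?C" and k: "k \<in> ?C" for h k
    unfolding join_blocks [OF within [OF h] within [OF k]]
  proof (rule blocks_mem_orbit_partitions [OF assms])
    show "equivalence_within \<Omega> (sup (?so h) (?so k))\<^sup>*\<^sup>*"
      by (rule equivalence_within_join [OF within [OF h] within [OF k]])
    show "invariant_equivalence (total_ext \<Omega> g) (sup (?so h) (?so k))\<^sup>*\<^sup>*"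
      using fin by (intro invariant_equivalence_join bij_g bij h k commute finite_orbits_total_ext [OF assms]) auto
  qed
  ultimately show ?thesis
    unfolding meet_coherent_def join_coherent_def partitions by blast
qed

end
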